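(* Let $\delta\ge 1$. Every graph $G$ with $n$ vertices and minimum degree $\delta$ contains a spanning subgraph $H$ satisfying $m(H)\le 16\frac{n}{\delta}+4$.
   Context: All graphs are finite and simple. For a graph $G$ and an integer $k\ge 0$, $m(G,k)$ denotes the number of vertices of degree exactly $k$ in $G$, and $m(G)=\max_k m(G,k)$. A spanning subgraph of $G$ is a subgraph with the same vertex set as $G$. *)

theory Defs
  imports Complex_Main
begin

definition simple_graph :: "'a set \<Rightarrow> 'a set set \<Rightarrow> bool" where
  "simple_graph V E \<longleftrightarrow> finite V \<and> (\<forall>e\<in>E. e \<subseteq> V \<and> card e = 2)"

definition degree :: "'a set set \<Rightarrow> 'a \<Rightarrow> nat" where
  "degree E v = card {e\<in>E. v \<in> e}"

definition min_degree :: "'a set \<Rightarrow> 'a set set \<Rightarrow> nat" where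
  "min_degree V E = Min (degree E ` V)"

definition mult_deg :: "'a set \<Rightarrow> 'a set set \<Rightarrow> nat \<Rightarrow> nat" where
  "mult_deg V E k = card {v\<in>V. degree E v = k}"

definition max_mult :: "'a set \<Rightarrow> 'a set set \<Rightarrow> nat" where
  "max_mult V E = Max (range (mult_deg V E))"

text \<open>H = (V, F) is a spanning subgraph of G = (V, E).\<close>
definition spanning_subgraph :: "'a set set \<Rightarrow> 'a set set \<Rightarrow> bool" where
  "spanning_subgraph F E \<longleftrightarrow> F \<subseteq> E"

end

theory Submission
  imports Defs
begin

text \<open>
  Give every edge a weight in {0, 1, 2, 3}, starting from 1, and process the vertices one by one.
  A processed vertex may change its weighted degree only within its bin {2t, 2t+1}; hence an edge
  from a new vertex \<open>v\<close> to a processed vertex can be altered by exactly one of +1 and -1, and an edge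
  to an unprocessed vertex by +1. All values in an interval of \<open>degree v + 1\<close> integers are
  therefore available at \<open>v\<close>, and a least loaded bin meeting this interval keeps every load at most
  2n/\<delta> + 1. Dividing the weights by 3 and rounding them to 0 or 1 as in the Beck-Fiala theorem
  changes each degree by less than 2, so that the vertices of a given degree come from six bins.
  The rounding moves the fractional edges along a direction that preserves the weighted degree of
  all vertices on at least three of them (there are fewer such vertices than fractional edges);
  any other vertex is on at most two, and each of these changes by less than 1 from then on.
\<close>

section \<open>Rounding fractional edge weights\<close>

lemma homogeneous_system_nontrivial_solution:
  fixes a :: "'c \<Rightarrow> 'i \<Rightarrow> 'f::field"
  assumes "finite C" "finite I" "card C < card I"
  shows "\<exists>x. (\<exists>i\<in>I. x i \<noteq> 0) \<and> (\<forall>c\<in>C. (\<Sum>i\<in>I. a c i * x i) = 0)"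
  using assms
proof (induction C arbitrary: I a rule: finite_induct)
  case empty
  then obtain i where "i \<in> I"
    by (metis card_gt_0_iff card.empty ex_in_conv)
  then show ?case
    by (intro exI[of _ "\<lambda>_. 1"]) auto
next
  case (insert c C)
  show ?case
  proof (cases "\<forall>i\<in>I. a c i = 0")
    case True
    have "card C < card I" using insert by simp
    from insert.IH[OF insert.prems(1) this, of a]
    obtain x where "\<exists>i\<in>I. x i \<noteq> 0" "\<forall>c\<in>C. (\<Sum>i\<in>I. a c i * x i) = 0"
      by blast
    with True show ?thesis
      by (intro exI[of _ x]) auto
  next
    case False
    then obtain p where p: "p \<in> I" "a c p \<noteq> 0"
      by blast
    let ?I = "I - {p}"
    \<comment> \<open>Gaussian elimination with pivot \<open>p\<close>: \<open>?b\<close> holds the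
      coefficients left after equation \<open>c\<close> is solved for the unknown \<open>p\<close>
      and the result is substituted into the other equations.\<close>
    let ?b = "\<lambda>c' i. a c' i - a c' p * a c i / a c p"
    have "card C < card ?I"
      using insert p by simp
    then obtain x where x: "\<exists>i\<in>?I. x i \<noteq> 0" "\<And>c'. c' \<in> C \<Longrightarrow> (\<Sum>i\<in>?I. ?b c' i * x i) = 0"
      using insert.IH[of ?I ?b] insert.prems by auto
    define q where "q = - (\<Sum>i\<in>?I. a c i * x i) / a c p"
    define z where "z = x(p := q)"
    have sum_z: "(\<Sum>i\<in>I. a c' i * z i) = a c' p * q + (\<Sum>i\<in>?I. a c' i * x i)" for c'
    proof -
      have "(\<Sum>i\<in>?I. a c' i * z i) = (\<Sum>i\<in>?I. a c' i * x i)"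
        by (rule sum.cong) (auto simp: z_def)
      then show ?thesis
        using p insert.prems by (simp add: sum.remove[of I p] z_def)
    qed
    have "(\<Sum>i\<in>I. a c' i * z i) = 0" if "c' \<in> insert c C" for c'
    proof (cases "c' = c")
      case True
      then show ?thesis
        using p by (simp add: sum_z q_def)
    next
      case False
      then have "0 = (\<Sum>i\<in>?I. ?b c' i * x i)"
        using that x by auto
      also have "\<dots> = (\<Sum>i\<in>?I. a c' i * x i) - a c' p / a c p * (\<Sum>i\<in>?I. a c i * x i)"
        by (simp add: sum_subtractf sum_distrib_left algebra_simps)
      finally show ?thesis
        by (simp add: sum_z q_def)
    qed
    moreover have "\<exists>i\<in>I. z i \<noteq> 0"
      using x(1) by (auto simp: z_def)
    ultimately show ?thesis
      by blast
  qed
qed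

text \<open>Double counting of incidences: each counted vertex lies on at least three edges, while
  an edge has only two ends. For nonempty \<open>D\<close> this leaves fewer vertex constraints than
  edge variables.\<close>

lemma card_degree_ge_3:
  assumes "finite D" "\<And>e. e \<in> D \<Longrightarrow> card e = 2"
  shows "finite {v. 3 \<le> degree D v}" "3 * card {v. 3 \<le> degree D v} \<le> 2 * card D"
proof -
  let ?A = "{v. 3 \<le> degree D v}"
  have fin_e: "finite e" if "e \<in> D" for e
    using assms(2)[OF that] by (metis card.infinite zero_neq_numeral)
  have "?A \<subseteq> \<Union>D"
  proof
    fix v assume "v \<in> ?A"
    then have "{e \<in> D. v \<in> e} \<noteq> {}"
      unfolding degree_def by (metis card.empty mem_Collect_eq not_numeral_le_zero)
    then show "v \<in> \<Union>D" by blast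
  qed
  then show fin: "finite ?A"
    using assms(1) fin_e by (meson finite_Union finite_subset)
  have "3 * card ?A \<le> (\<Sum>v\<in>?A. \<Sum>e | e \<in> D \<and> v \<in> e. 1)"
    using sum_bounded_below[of ?A 3 "degree D"] by (simp add: degree_def mult.commute)
  also have "\<dots> = (\<Sum>e\<in>D. \<Sum>v | v \<in> ?A \<and> v \<in> e. 1)"
    by (rule sum.swap_restrict[OF fin assms(1)])
  also have "\<dots> \<le> (\<Sum>e\<in>D. 2)"
  proof (rule sum_mono)
    fix e assume "e \<in> D"
    then show "(\<Sum>v | v \<in> ?A \<and> v \<in> e. 1) \<le> (2::nat)"
      using card_mono[of e "{v. v \<in> ?A \<and> v \<in> e}"] assms(2) fin_e by fastforce
  qed
  finally show "3 * card ?A \<le> 2 * card D"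
    by simp
qed

lemma move_to_boundary_of_cube:
  fixes y d :: "'e \<Rightarrow> real"
  assumes "finite D" "\<And>e. e \<in> D \<Longrightarrow> 0 < y e \<and> y e < 1" "\<exists>e\<in>D. d e \<noteq> 0"
  obtains t e0 where "\<And>e. e \<in> D \<Longrightarrow> 0 \<le> y e + t * d e \<and> y e + t * d e \<le> 1"
    and "e0 \<in> D" "y e0 + t * d e0 \<in> {0, 1}"
proof -
  let ?D = "{e \<in> D. d e \<noteq> 0}"
  \<comment> \<open>\<open>\<tau> e\<close> is the time at which coordinate \<open>e\<close>, moving
    with velocity \<open>d e\<close>, reaches the face 0 or 1; the motion stops at the first such
    time.\<close>
  define \<tau> where "\<tau> e = (if d e > 0 then (1 - y e) / d e else - y e / d e)" for e
  define t where "t = Min (\<tau> ` ?D)"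
  have D: "finite (\<tau> ` ?D)" "\<tau> ` ?D \<noteq> {}"
    using assms by auto
  obtain e0 where e0: "e0 \<in> ?D" "t = \<tau> e0"
    using Min_in[OF D] unfolding t_def by blast
  have "0 < t"
    using e0 assms(2)[of e0] by (auto simp: \<tau>_def divide_simps)
  have "0 \<le> y e + t * d e \<and> y e + t * d e \<le> 1" if e: "e \<in> D" for e
  proof -
    consider "d e = 0" | "d e > 0" | "d e < 0" by linarith
    then show ?thesis
    proof cases
      case 1
      then show ?thesis using assms(2)[OF e] by simp
    next
      case 2
      then have "t \<le> (1 - y e) / d e"
        using Min_le[OF D(1), of "\<tau> e"] e by (simp add: t_def \<tau>_def)
      then have "t * d e \<le> 1 - y e" using 2 by (simp add: pos_le_divide_eq)
      moreover have "0 < t * d e" using 2 \<open>0 < t\<close> by simp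
      ultimately show ?thesis using assms(2)[OF e] by simp
    next
      case 3
      then have "t \<le> - y e / d e"
        using Min_le[OF D(1), of "\<tau> e"] e by (simp add: t_def \<tau>_def)
      then have "- y e \<le> t * d e" using 3 by (simp add: field_simps)
      moreover have "t * d e < 0" using 3 \<open>0 < t\<close> by (simp add: mult_pos_neg)
      ultimately show ?thesis using assms(2)[OF e] by simp
    qed
  qed
  moreover have "y e0 + t * d e0 \<in> {0, 1}"
    using e0 by (auto simp: \<tau>_def)
  ultimately show thesis
    using that e0 by blast
qed

text \<open>Induction on the number of fractional edges; each move makes at least one of them
  integral. The clause on values already in {0, 1} belongs to the induction, since it freezes an
  edge once it is integral.\<close>

lemma edge_weight_rounding:
  fixes y :: "'a set \<Rightarrow> real"
  assumes "finite E" "\<And>e. e \<in> E \<Longrightarrow> card e = 2" "\<And>e. e \<in> E \<Longrightarrow> 0 \<le> y e \<and> y e \<le> 1"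
  shows "\<exists>x. (\<forall>e\<in>E. x e \<in> {0, 1} \<and> (y e \<in> {0, 1} \<longrightarrow> x e = y e)) \<and>
    (\<forall>v. \<bar>(\<Sum>e | e \<in> E \<and> v \<in> e. x e) - (\<Sum>e | e \<in> E \<and> v \<in> e. y e)\<bar> < 2)"
  using assms(3)
proof (induction "card {e \<in> E. 0 < y e \<and> y e < 1}" arbitrary: y rule: less_induct)
  case less
  let ?D = "{e \<in> E. 0 < y e \<and> y e < 1}"
  have fin: "finite ?D" using assms(1) by simp
  show ?case
  proof (cases "?D = {}")
    case True
    then have "\<forall>e\<in>E. y e \<in> {0, 1}" using less.prems by force
    then show ?thesis by (intro exI[of _ y]) auto
  next
    case False
    let ?A = "{v. 3 \<le> degree ?D v}"
    have A: "finite ?A" "card ?A < card ?D"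
    proof -
      have "0 < card ?D" using False fin by (simp add: card_gt_0_iff)
      then show "finite ?A" "card ?A < card ?D"
        using card_degree_ge_3[OF fin] assms(2) by auto
    qed
    obtain d where d: "\<exists>e\<in>?D. d e \<noteq> 0"
      "\<And>v. v \<in> ?A \<Longrightarrow> (\<Sum>e\<in>?D. (if v \<in> e then 1 else 0) * d e) = (0::real)"
      using homogeneous_system_nontrivial_solution[OF A(1) fin A(2),
          of "\<lambda>v e. if v \<in> e then 1 else 0"] by auto
    obtain t e0 where t: "\<And>e. e \<in> ?D \<Longrightarrow> 0 \<le> y e + t * d e \<and> y e + t * d e \<le> 1"
      and e0: "e0 \<in> ?D" "y e0 + t * d e0 \<in> {0, 1}"
      using move_to_boundary_of_cube[OF fin _ d(1), of y] by auto
    define y' where "y' e = (if e \<in> ?D then y e + t * d e else y e)" for e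
    have y'_range: "0 \<le> y' e \<and> y' e \<le> 1" if "e \<in> E" for e
      using t[of e] less.prems[OF that] unfolding y'_def by (auto split: if_splits)
    have "{e \<in> E. 0 < y' e \<and> y' e < 1} \<subseteq> ?D"
      by (auto simp: y'_def split: if_splits)
    moreover have "e0 \<notin> {e \<in> E. 0 < y' e \<and> y' e < 1}"
      using e0 by (auto simp: y'_def)
    ultimately have "card {e \<in> E. 0 < y' e \<and> y' e < 1} < card ?D"
      using e0(1) by (intro psubset_card_mono[OF fin]) blast
    from less.hyps[OF this y'_range] obtain x where
      x: "\<And>e. e \<in> E \<Longrightarrow> x e \<in> {0, 1}" "\<And>e. e \<in> E \<Longrightarrow> y' e \<in> {0, 1} \<Longrightarrow> x e = y' e"
      "\<And>v. \<bar>(\<Sum>e | e \<in> E \<and> v \<in> e. x e) - (\<Sum>e | e \<in> E \<and> v \<in> e. y' e)\<bar> < 2"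
      by blast
    \<comment> \<open>Frozen edges keep their value through all later moves, so \<open>x\<close> and
      \<open>y\<close> can differ only on \<open>?D\<close>.\<close>
    have off_D: "x e = y e" if "e \<in> E - ?D" for e
    proof -
      have "y' e = y e" "y e \<in> {0, 1}" using that less.prems[of e] by (auto simp: y'_def)
      then show ?thesis using that x(2) by simp
    qed
    have "\<bar>(\<Sum>e | e \<in> E \<and> v \<in> e. x e) - (\<Sum>e | e \<in> E \<and> v \<in> e. y e)\<bar> < 2" for v
    proof (cases "v \<in> ?A")
      \<comment> \<open>This move preserves the sum at \<open>v\<close>, so the bound for
        \<open>y'\<close> is also the bound for \<open>y\<close>.\<close>
      case True
      have "(\<Sum>e | e \<in> E \<and> v \<in> e. y' e) - (\<Sum>e | e \<in> E \<and> v \<in> e. y e)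
          = (\<Sum>e | e \<in> E \<and> v \<in> e. if e \<in> ?D then t * d e else 0)"
        unfolding sum_subtractf[symmetric] by (rule sum.cong) (auto simp: y'_def)
      also have "\<dots> = (\<Sum>e\<in>?D. if v \<in> e then t * d e else 0)"
        using assms(1) by (intro sum.mono_neutral_cong) auto
      also have "\<dots> = t * (\<Sum>e\<in>?D. (if v \<in> e then 1 else 0) * d e)"
        unfolding sum_distrib_left by (rule sum.cong) auto
      finally show ?thesis using d(2)[OF True] x(3)[of v] by simp
    next
      \<comment> \<open>Here \<open>x\<close> is compared with \<open>y\<close> directly, bypassing
        \<open>y'\<close>: at most two edges at \<open>v\<close> are fractional, and each ends less
        than 1 away from its present value.\<close>
      case False
      let ?B = "{e \<in> ?D. v \<in> e}"
      have "(\<Sum>e | e \<in> E \<and> v \<in> e. x e) - (\<Sum>e | e \<in> E \<and> v \<in> e. y e) = (\<Sum>e\<in>?B. x e - y e)"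
        unfolding sum_subtractf[symmetric] using assms(1) off_D
        by (intro sum.mono_neutral_right) auto
      moreover have "\<bar>\<Sum>e\<in>?B. x e - y e\<bar> < 2"
      \<comment> \<open>The termwise strict inequality sums to a strict one only over a nonempty
        set.\<close>
      proof (cases "?B = {}")
        case False
        have "\<bar>\<Sum>e\<in>?B. x e - y e\<bar> \<le> (\<Sum>e\<in>?B. \<bar>x e - y e\<bar>)" by (rule sum_abs)
        also have "\<dots> < (\<Sum>e\<in>?B. 1)"
        proof (rule sum_strict_mono)
          show "\<bar>x e - y e\<bar> < 1" if "e \<in> ?B" for e
            using that x(1)[of e] by auto
        qed (use assms(1) False in auto)
        also have "\<dots> \<le> 2"
          using \<open>v \<notin> ?A\<close> by (simp add: degree_def)
        finally show ?thesis .
      next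
        case True
        then have "(\<Sum>e\<in>?B. x e - y e) = 0" by (metis sum.empty)
        then show ?thesis by simp
      qed
      ultimately show ?thesis by simp
    qed
    moreover have "x e = y e" if "e \<in> E" "y e \<in> {0, 1}" for e
      using off_D[of e] that by auto
    ultimately show ?thesis
      using x(1) by blast
  qed
qed

corollary edge_weight_rounding_subgraph:
  fixes y :: "'a set \<Rightarrow> real"
  assumes "finite E" "\<And>e. e \<in> E \<Longrightarrow> card e = 2" "\<And>e. e \<in> E \<Longrightarrow> 0 \<le> y e \<and> y e \<le> 1"
  obtains F where "F \<subseteq> E" "\<And>v. \<bar>real (degree F v) - (\<Sum>e | e \<in> E \<and> v \<in> e. y e)\<bar> < 2"
proof -
  from edge_weight_rounding[of E y, OF assms] obtain x where
    x: "\<forall>e\<in>E. x e \<in> {0, 1} \<and> (y e \<in> {0, 1} \<longrightarrow> x e = y e)"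
    "\<forall>v. \<bar>(\<Sum>e | e \<in> E \<and> v \<in> e. x e) - (\<Sum>e | e \<in> E \<and> v \<in> e. y e)\<bar> < 2"
    by blast
  let ?F = "{e \<in> E. x e = 1}"
  have "real (degree ?F v) = (\<Sum>e | e \<in> E \<and> v \<in> e. x e)" for v
  proof -
    have "real (degree ?F v) = (\<Sum>e | e \<in> ?F \<and> v \<in> e. x e)"
      by (simp add: degree_def)
    also have "\<dots> = (\<Sum>e | e \<in> E \<and> v \<in> e. x e)"
      using assms(1) x(1) by (intro sum.mono_neutral_left) auto
    finally show ?thesis .
  qed
  then show thesis
    using that[of ?F] x(2) by auto
qed

section \<open>Spreading the weighted degrees over bins\<close>

lemma sub_sum_of_signs:
  fixes \<epsilon> :: "'e \<Rightarrow> int"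
  assumes "finite N" "\<And>e. e \<in> N \<Longrightarrow> \<epsilon> e \<in> {1, -1}"
    and "- int (card {e \<in> N. \<epsilon> e = -1}) \<le> k" "k \<le> int (card {e \<in> N. \<epsilon> e = 1})"
  obtains T where "T \<subseteq> N" "(\<Sum>e\<in>T. \<epsilon> e) = k"
proof (cases "0 \<le> k")
  \<comment> \<open>A nonnegative target is reached with signs +1 alone, a negative one with signs
    -1 alone.\<close>
  case True
  then have "nat k \<le> card {e \<in> N. \<epsilon> e = 1}" using assms(4) by simp
  then obtain T where T: "T \<subseteq> {e \<in> N. \<epsilon> e = 1}" "card T = nat k"
    by (metis obtain_subset_with_card_n)
  then have "(\<Sum>e\<in>T. \<epsilon> e) = (\<Sum>e\<in>T. 1)" by (intro sum.cong) auto
  then show thesis using that[of T] T True by auto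
next
  case False
  then have "nat (- k) \<le> card {e \<in> N. \<epsilon> e = -1}" using assms(3) by simp
  then obtain T where T: "T \<subseteq> {e \<in> N. \<epsilon> e = -1}" "card T = nat (- k)"
    by (metis obtain_subset_with_card_n)
  then have "(\<Sum>e\<in>T. \<epsilon> e) = (\<Sum>e\<in>T. -1)" by (intro sum.cong) auto
  then show thesis using that[of T] T False by auto
qed

text \<open>Pigeonhole: the interval meets at least half as many bins {2t, 2t+1} as it has integers,
  and the bins are disjoint, so they cannot all have load \<open>L\<close> or more.\<close>

lemma light_bin_in_interval:
  fixes f :: "'a \<Rightarrow> int" and a b :: int
  assumes "finite S" "a \<le> b" "2 * int (card S) < int L * (b - a + 1)"
  obtains x where "a \<le> x" "x \<le> b" "card {u \<in> S. f u div 2 = x div 2} < L"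
proof -
  let ?B = "{a div 2..b div 2}"
  have "\<exists>t\<in>?B. card {u \<in> S. f u div 2 = t} < L"
  proof (rule ccontr)
    assume "\<not> ?thesis"
    then have "card ?B * L \<le> (\<Sum>t\<in>?B. card {u \<in> S. f u div 2 = t})"
      using sum_bounded_below[of ?B L "\<lambda>t. card {u \<in> S. f u div 2 = t}"] by (simp add: not_less)
    also have "\<dots> = card (\<Union>t\<in>?B. {u \<in> S. f u div 2 = t})"
      using assms(1) by (intro card_UN_disjoint[symmetric]) auto
    also have "\<dots> \<le> card S"
      using assms(1) by (intro card_mono) auto
    finally have "int (card ?B) * int L \<le> int (card S)"
      by (metis of_nat_le_iff of_nat_mult)
    moreover have "b - a + 1 \<le> 2 * int (card ?B)"
      using assms(2) by simp
    then have "int L * (b - a + 1) \<le> int L * (2 * int (card ?B))"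
      by (intro mult_left_mono) auto
    ultimately show False
      using assms(3) by (simp add: algebra_simps)
  qed
  then obtain t where t: "t \<in> ?B" "card {u \<in> S. f u div 2 = t} < L"
    by blast
  \<comment> \<open>The least element of bin \<open>t\<close> inside the interval; the lowest bin
    may start at \<open>a - 1\<close>.\<close>
  have "a \<le> max a (2 * t)" "max a (2 * t) \<le> b" "max a (2 * t) div 2 = t"
    using t(1) assms(2) by (auto simp: max_def)
  then show thesis
    using that t(2) by metis
qed

definition wdegree :: "'a set set \<Rightarrow> ('a set \<Rightarrow> int) \<Rightarrow> 'a \<Rightarrow> int" where
  "wdegree E w v = (\<Sum>e | e \<in> E \<and> v \<in> e. w e)"

text \<open>The clauses on edges not inside \<open>S\<close> are the induction invariant. An edge is
  altered at most once for each end: by +1 from 1 if its other end is still unprocessed, and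
  otherwise by either sign from 1 or 2, so it stays in {0..3}.\<close>

lemma spread_weights:
  assumes graph: "simple_graph V E" and deg: "\<And>v. v \<in> V \<Longrightarrow> \<delta> \<le> degree E v"
    and L: "2 * card V < L * \<delta>" and "S \<subseteq> V"
  shows "\<exists>w. (\<forall>e\<in>E. w e \<in> {0..3}) \<and> (\<forall>e\<in>E. \<not> e \<subseteq> S \<longrightarrow> w e \<in> {1, 2}) \<and>
    (\<forall>e\<in>E. e \<inter> S = {} \<longrightarrow> w e = 1) \<and> (\<forall>t. card {u \<in> S. wdegree E w u div 2 = t} \<le> L)"
proof -
  have "finite V" and E: "\<And>e. e \<in> E \<Longrightarrow> e \<subseteq> V \<and> card e = 2"
    using graph by (auto simp: simple_graph_def)
  then have "finite E"
    by (intro finite_subset[of E "Pow V"]) auto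
  have "finite S" using \<open>S \<subseteq> V\<close> \<open>finite V\<close> by (rule finite_subset)
  then show ?thesis using \<open>S \<subseteq> V\<close>
  proof (induction S rule: finite_induct)
    case empty
    show ?case by (intro exI[of _ "\<lambda>_. 1"]) auto
  next
    case (insert v S)
    have "S \<subseteq> V" using insert.prems by simp
    from insert.IH[OF this] obtain w where w: "\<forall>e\<in>E. w e \<in> {0..3}"
      "\<forall>e\<in>E. \<not> e \<subseteq> S \<longrightarrow> w e \<in> {1, 2}" "\<forall>e\<in>E. e \<inter> S = {} \<longrightarrow> w e = 1"
      "\<forall>t. card {u \<in> S. wdegree E w u div 2 = t} \<le> L"
      by (elim exE conjE)
    let ?N = "{e \<in> E. v \<in> e}"
    \<comment> \<open>The only unit change that keeps a processed neighbour in its bin: down from an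
      odd value, up from an even one. Edges to unprocessed vertices get +1.\<close>
    define \<epsilon> :: "'a set \<Rightarrow> int" where
      "\<epsilon> e = (if \<exists>u\<in>e \<inter> S. odd (wdegree E w u) then -1 else 1)" for e
    let ?p = "int (card {e \<in> ?N. \<epsilon> e = 1})" and ?q = "int (card {e \<in> ?N. \<epsilon> e = -1})"
    have "card ?N = card ({e \<in> ?N. \<epsilon> e = 1} \<union> {e \<in> ?N. \<epsilon> e = -1})"
      by (rule arg_cong[of _ _ card]) (auto simp: \<epsilon>_def)
    also have "\<dots> = card {e \<in> ?N. \<epsilon> e = 1} + card {e \<in> ?N. \<epsilon> e = -1}"
      using \<open>finite E\<close> by (intro card_Un_disjoint) auto
    finally have "int \<delta> \<le> ?p + ?q"
      using deg[of v] insert.prems by (simp add: degree_def)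
    then have "int L * int \<delta> \<le> int L * (?p + ?q + 1)"
      by (intro mult_left_mono) auto
    moreover have "2 * int (card V) < int L * int \<delta>"
      using L by (metis of_nat_less_iff of_nat_mult of_nat_numeral)
    moreover have "card S \<le> card V"
      using insert.prems \<open>finite V\<close> by (intro card_mono) auto
    ultimately have room: "2 * int (card S) < int L * (?p + ?q + 1)"
      by linarith
    \<comment> \<open>Altering a subset of the edges at \<open>v\<close> reaches every value in this
      interval. It has \<open>?p + ?q + 1\<close> elements, one more than the degree of
      \<open>v\<close>.\<close>
    obtain s where s: "wdegree E w v - ?q \<le> s" "s \<le> wdegree E w v + ?p"
      "card {u \<in> S. wdegree E w u div 2 = s div 2} < L"
      using light_bin_in_interval[of S "wdegree E w v - ?q" "wdegree E w v + ?p" L "wdegree E w"]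
        room insert.hyps(1) by (auto simp: algebra_simps)
    obtain T where T: "T \<subseteq> ?N" "(\<Sum>e\<in>T. \<epsilon> e) = s - wdegree E w v"
      by (rule sub_sum_of_signs[of ?N \<epsilon> "s - wdegree E w v"])
        (use s \<open>finite E\<close> in \<open>auto simp: \<epsilon>_def\<close>)
    define w' where "w' e = w e + (if e \<in> T then \<epsilon> e else 0)" for e
    have wdegree_w': "wdegree E w' u = wdegree E w u + (\<Sum>e | e \<in> T \<and> u \<in> e. \<epsilon> e)" for u
    proof -
      have "(\<Sum>e | e \<in> E \<and> u \<in> e. if e \<in> T then \<epsilon> e else 0) = (\<Sum>e | e \<in> T \<and> u \<in> e. \<epsilon> e)"
        using T(1) \<open>finite E\<close> by (intro sum.mono_neutral_cong_right) auto
      then show ?thesis by (simp add: wdegree_def w'_def sum.distrib)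
    qed
    \<comment> \<open>By simplicity of the graph, a vertex other than \<open>v\<close> is on at most
      one altered edge.\<close>
    have edge: "e = {v, u}" if "e \<in> T" "u \<in> e" "u \<noteq> v" for e u
    proof -
      have "card e = 2" "{v, u} \<subseteq> e" "card {v, u} = 2" using that T(1) E by auto
      then show ?thesis by (metis card_subset_eq card.infinite zero_neq_numeral)
    qed
    have bin_v: "wdegree E w' v = s"
    proof -
      have "{e. e \<in> T \<and> v \<in> e} = T" using T(1) by auto
      then show ?thesis using T(2) by (simp add: wdegree_w')
    qed
    have bin_S: "wdegree E w' u div 2 = wdegree E w u div 2" if u: "u \<in> S" for u
    proof -
      have "u \<noteq> v" using u insert.hyps by blast
      show ?thesis
      proof (cases "{v, u} \<in> T")
        case True
        have "e \<in> T \<and> u \<in> e \<longleftrightarrow> e = {v, u}" for e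
          using edge[of e u] \<open>u \<noteq> v\<close> True by blast
        then have "{e. e \<in> T \<and> u \<in> e} = {{v, u}}" by blast
        moreover have "{v, u} \<inter> S = {u}" using u insert.hyps by auto
        ultimately have "wdegree E w' u = wdegree E w u + (if odd (wdegree E w u) then -1 else 1)"
          by (simp add: wdegree_w' \<epsilon>_def)
        then show ?thesis by (auto elim!: evenE oddE)
      next
        case False
        then have "\<not> (e \<in> T \<and> u \<in> e)" for e
          using edge[of e u] \<open>u \<noteq> v\<close> by blast
        then have "{e. e \<in> T \<and> u \<in> e} = {}" by blast
        then show ?thesis by (simp only: wdegree_w' sum.empty add_0_right)
      qed
    qed
    have "w' e \<in> {0..3}" if "e \<in> E" for e
    proof (cases "e \<in> T")
      case True
      then have "\<not> e \<subseteq> S" using T(1) insert.hyps by auto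
      then have "w e \<in> {1, 2}" using w(2) that by blast
      then show ?thesis by (auto simp: w'_def \<epsilon>_def)
    qed (use w(1) that in \<open>simp add: w'_def\<close>)
    moreover have "w' e \<in> {1, 2}" if e: "e \<in> E" "\<not> e \<subseteq> insert v S" for e
    proof (cases "e \<in> T")
      case True
      \<comment> \<open>The other end \<open>u\<close> of \<open>e\<close> is unprocessed, so the
        weight was 1 and the sign is +1, giving 2.\<close>
      obtain u where u: "u \<in> e" "u \<notin> insert v S" using e by blast
      then have "e \<inter> S = {}" using edge[OF True, of u] insert.hyps by auto
      then show ?thesis using w(3) e by (simp add: w'_def \<epsilon>_def)
    qed (use w(2) e in \<open>auto simp: w'_def\<close>)
    moreover have "w' e = 1" if "e \<in> E" "e \<inter> insert v S = {}" for e
      using that T(1) w(3) by (auto simp: w'_def)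
    moreover have "card {u \<in> insert v S. wdegree E w' u div 2 = t} \<le> L" for t
    proof (cases "t = s div 2")
      \<comment> \<open>Only the bin that receives \<open>v\<close> gains a vertex, and its load was
        strictly below \<open>L\<close>.\<close>
      case True
      then have "{u \<in> insert v S. wdegree E w' u div 2 = t}
          = insert v {u \<in> S. wdegree E w u div 2 = s div 2}"
        using bin_v bin_S by auto
      then show ?thesis using s(3) insert.hyps by simp
    next
      case False
      then have "{u \<in> insert v S. wdegree E w' u div 2 = t} = {u \<in> S. wdegree E w u div 2 = t}"
        using bin_v bin_S by auto
      then show ?thesis using w(4) by simp
    qed
    ultimately show ?case by (intro exI[of _ w']) blast
  qed
qed

section \<open>From spread weights to the spanning subgraph\<close>

theorem theorem1p6:
  fixes V :: "'a set" and E :: "'a set set" and \<delta> :: nat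
  assumes "simple_graph V E"
    and "V \<noteq> {}"
    and "\<delta> \<ge> 1"
    and "min_degree V E = \<delta>"
  shows "\<exists>F. spanning_subgraph F E \<and>
           real (max_mult V F) \<le> 16 * real (card V) / real \<delta> + 4"
proof -
  have "finite V" and E: "\<And>e. e \<in> E \<Longrightarrow> e \<subseteq> V \<and> card e = 2"
    using assms(1) by (auto simp: simple_graph_def)
  then have "finite E"
    by (intro finite_subset[of E "Pow V"]) auto
  have deg: "\<delta> \<le> degree E v" if "v \<in> V" for v
    using that \<open>finite V\<close> assms(4) by (auto simp: min_degree_def)
  \<comment> \<open>The least integer with \<open>2 * card V < L * \<delta>\<close>.\<close>
  define L where "L = 2 * card V div \<delta> + 1"
  have "2 * card V < L * \<delta>"
    using assms(3) dividend_less_div_times[of \<delta> "2 * card V"] by (simp add: L_def algebra_simps)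
  then obtain w where w: "\<And>e. e \<in> E \<Longrightarrow> w e \<in> {0..3}"
    "\<And>t. card {v \<in> V. wdegree E w v div 2 = t} \<le> L"
    using spread_weights[OF assms(1) deg, of L V] by auto
  have "0 \<le> real_of_int (w e) / 3 \<and> real_of_int (w e) / 3 \<le> 1" if "e \<in> E" for e
    using w(1)[OF that] by simp
  then obtain F where F: "F \<subseteq> E"
    "\<And>v. \<bar>real (degree F v) - (\<Sum>e | e \<in> E \<and> v \<in> e. real_of_int (w e) / 3)\<bar> < 2"
    using edge_weight_rounding_subgraph[of E "\<lambda>e. real_of_int (w e) / 3"] \<open>finite E\<close> E
    by blast
  \<comment> \<open>Tripling the rounding error gives a bound strictly below 6; between integers
    this means at most 5.\<close>
  have close: "\<bar>3 * int (degree F v) - wdegree E w v\<bar> \<le> 5" for v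
  proof -
    have "(\<Sum>e | e \<in> E \<and> v \<in> e. real_of_int (w e) / 3) = real_of_int (wdegree E w v) / 3"
      by (simp add: wdegree_def sum_divide_distrib)
    then show ?thesis using F(2)[of v] by linarith
  qed
  have mult: "mult_deg V F k \<le> 6 * L" for k
  proof -
    \<comment> \<open>The ends of the interval from 3k - 5 to 3k + 5 differ by 10, so for either
      parity of k it meets exactly six bins.\<close>
    let ?B = "{(3 * int k - 5) div 2..(3 * int k + 5) div 2}"
    have "{v \<in> V. degree F v = k} \<subseteq> (\<Union>t\<in>?B. {v \<in> V. wdegree E w v div 2 = t})"
    proof
      fix v assume "v \<in> {v \<in> V. degree F v = k}"
      moreover from this have "wdegree E w v div 2 \<in> ?B"
        using close[of v] by (auto intro!: zdiv_mono1)
      ultimately show "v \<in> (\<Union>t\<in>?B. {v \<in> V. wdegree E w v div 2 = t})" by blast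
    qed
    then have "mult_deg V F k \<le> card (\<Union>t\<in>?B. {v \<in> V. wdegree E w v div 2 = t})"
      unfolding mult_deg_def using \<open>finite V\<close> by (intro card_mono) auto
    also have "\<dots> \<le> (\<Sum>t\<in>?B. card {v \<in> V. wdegree E w v div 2 = t})"
      by (rule card_UN_le) simp
    also have "\<dots> \<le> of_nat (card ?B) * L"
      by (rule sum_bounded_above) (rule w(2))
    also have "card ?B = 6" by simp
    finally show ?thesis by simp
  qed
  then have "max_mult V F \<le> 6 * L"
  proof -
    \<comment> \<open>\<open>Max\<close> is taken over all k at once; the uniform bound on the
      multiplicities makes their range finite.\<close>
    have "finite (range (mult_deg V F))"
      by (rule finite_subset[of _ "{..6 * L}"]) (use mult in auto)
    then show ?thesis using mult by (simp add: max_mult_def)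
  qed
  moreover have "real L \<le> 2 * real (card V) / real \<delta> + 1"
    using of_nat_div_le_of_nat[of "2 * card V" \<delta>, where ?'a = real] by (simp add: L_def)
  \<comment> \<open>So far the bound is 6L, at most 12n/\<delta> + 6. Since n/\<delta> is at least
    1, the excess of 2 over the constant 4 is absorbed into the term 16n/\<delta>.\<close>
  moreover have "1 \<le> real (card V) / real \<delta>"
  proof -
    obtain v where v: "v \<in> V" using assms(2) by blast
    have "{e \<in> E. v \<in> e} \<subseteq> (\<lambda>u. {v, u}) ` V"
    proof
      fix e assume "e \<in> {e \<in> E. v \<in> e}"
      then have "e \<subseteq> V" "card e = 2" "v \<in> e" using E by auto
      then show "e \<in> (\<lambda>u. {v, u}) ` V" by (auto simp: card_2_iff)
    qed
    then have "degree E v \<le> card V"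
      unfolding degree_def using \<open>finite V\<close> by (metis surj_card_le)
    then show ?thesis using deg[OF v] assms(3) by (simp add: divide_simps)
  qed
  ultimately have "real (max_mult V F) \<le> 16 * real (card V) / real \<delta> + 4"
    by simp
  then show ?thesis using F(1) by (auto simp: spanning_subgraph_def)
qed

end
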